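(* Let $n\in\mathbb{N}$ (a positive integer) and let $c>0$ be real. Then the function $$\psi_{n,c}(x)=\sum_{k=0}^{\infty}\left(p_{n,k}^{[c]}(x)\right)^2,\quad x\geq 0,$$ is completely monotonic.
   Context: For $n\in\mathbb{N}$, $k\in\mathbb{N}\cup\{0\}$ and real $c>0$, the (generalized) Baskakov basis functions are $$p_{n,k}^{[c]}(x)=\binom{-n/c}{k}(-cx)^k(1+cx)^{-n/c-k},\quad x\geq 0,$$ where $\binom{a}{k}=\frac{a(a-1)\cdots(a-k+1)}{k!}$ is the generalized binomial coefficient and $0^0=1$. A function $f:[0,\infty)\to\mathbb{R}$ is completely monotonic (in the sense of Bernstein's theorem) if it is continuous on $[0,\infty)$, infinitely differentiable on $(0,\infty)$, and $(-1)^m f^{(m)}(x)\geq 0$ for all $x>0$ and all integers $m\geq 0$. *)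

theory Defs
  imports "HOL-Analysis.Analysis"
begin

text \<open>Only the values at \<open>x \<ge> 0\<close> matter; there \<open>1 + c * x > 0\<close>, so \<open>powr\<close> is the genuine real power.\<close>

definition baskakov_basis :: "real \<Rightarrow> nat \<Rightarrow> nat \<Rightarrow> real \<Rightarrow> real" where
  "baskakov_basis c n k x =
     ((- real n / c) gchoose k) * (- c * x) ^ k * (1 + c * x) powr (- real n / c - real k)"

definition baskakov_psi :: "nat \<Rightarrow> real \<Rightarrow> real \<Rightarrow> real" where
  "baskakov_psi n c x = (\<Sum>k. (baskakov_basis c n k x)\<^sup>2)"

text \<open>A function on \<open>[0, \<infinity>)\<close> is represented by a total function whose values at negative arguments are
  ignored: iterated derivatives are constrained only at points of the open set \<open>(0, \<infinity>)\<close>, where they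
  depend only on the values of \<open>f\<close> on that set. Differentiability of every iterated derivative is required
  explicitly because \<open>deriv\<close> is total.\<close>

definition completely_monotonic :: "(real \<Rightarrow> real) \<Rightarrow> bool" where
  "completely_monotonic f \<longleftrightarrow>
     continuous_on {0..} f \<and>
     (\<forall>m. \<forall>x>0. ((deriv ^^ m) f) field_differentiable (at x)) \<and>
     (\<forall>m. \<forall>x>0. (-1) ^ m * (deriv ^^ m) f x \<ge> 0)"

end

theory Submission
  imports Defs
begin

text \<open>
  Put \<open>a = n / c\<close> and \<open>y = c * x\<close>. The basis functions are the negative binomial probabilities, that is,
  Poisson probabilities \<open>exp (- y * l) * (y * l) ^ k / k!\<close> averaged over a Gamma-distributed \<open>l\<close> with
  parameter \<open>a\<close>. Squaring, with independent copies \<open>l\<close>, \<open>m\<close>, and summing over \<open>k\<close> turns the Poisson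
  probabilities into \<open>exp (- y * (l + m)) * I\<^sub>0 (2 * y * sqrt (l * m))\<close>. As \<open>I\<^sub>0 z\<close> is the average of
  \<open>cosh (z * sqrt t)\<close> over the arcsine distribution of \<open>t \<in> [0, 1]\<close>, the function \<open>\<psi>\<close> is half the sum of
  the averages of \<open>exp (- y * (l + m \<plusminus> 2 * sqrt (l * m * t)))\<close>. These exponents are nonpositive by
  AM-GM, so \<open>\<psi>\<close> is a Laplace transform of a positive measure.
\<close>

section \<open>Complete monotonicity from a chain of derivatives\<close>

text \<open>Here \<open>g m\<close> plays the role of (-1)^m times the m-th derivative of
  \<open>f\<close>. The alternating sign is absorbed into the derivative rule, so that all
  \<open>g m\<close> are simply nonnegative.\<close>

lemma completely_monotonicI:
  fixes f :: "real \<Rightarrow> real" and g :: "nat \<Rightarrow> real \<Rightarrow> real"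
  assumes cont: "continuous_on {0..} f"
    and f: "\<And>x. x > 0 \<Longrightarrow> f x = g 0 x"
    and deriv: "\<And>m x. x > 0 \<Longrightarrow> (g m has_real_derivative - g (Suc m) x) (at x)"
    and nonneg: "\<And>m x. x > 0 \<Longrightarrow> g m x \<ge> 0"
  shows "completely_monotonic f"
proof -
  \<comment> \<open>A derivative at \<open>x > 0\<close> sees only values on the open half-line, so
    an identity valid there can be differentiated and the induction on \<open>m\<close> can
    proceed.\<close>
  have transfer: "(h has_real_derivative D) (at x)"
    if "(k has_real_derivative D) (at x)" "\<And>y. y > 0 \<Longrightarrow> h y = k y" "x > 0" for h k D and x :: real
    using has_field_derivative_transform_within_open[OF that(1), of "{0<..}" h] that by auto
  have iter: "(deriv ^^ m) f x = (-1) ^ m * g m x" if "x > 0" for m x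
    using that
  proof (induction m arbitrary: x)
    case (Suc m)
    have "((\<lambda>x. (-1) ^ m * g m x) has_real_derivative (-1) ^ m * (- g (Suc m) x)) (at x)"
      using deriv[OF Suc.prems] by (rule DERIV_cmult)
    hence "((deriv ^^ m) f has_real_derivative (-1) ^ m * (- g (Suc m) x)) (at x)"
      using Suc.IH Suc.prems by (rule transfer)
    thus ?case by (simp add: DERIV_imp_deriv)
  qed (simp add: f)
  have "(deriv ^^ m) f field_differentiable (at x)" if "x > 0" for m x
    unfolding field_differentiable_def
    using transfer[OF DERIV_cmult[OF deriv[OF that]] iter that] by blast
  moreover have "(-1) ^ m * (deriv ^^ m) f x \<ge> 0" if "x > 0" for m x
  proof -
    have "(-1) ^ m * (deriv ^^ m) f x = ((-1) ^ m * (-1) ^ m) * g m x"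
      by (simp only: iter[OF that] mult.assoc)
    thus ?thesis using nonneg[OF that] by (simp flip: power_mult_distrib)
  qed
  ultimately show ?thesis using cont by (simp add: completely_monotonic_def)
qed

section \<open>Laplace transforms over finite measures: differentiation and continuity\<close>

text \<open>Everything follows from 1 + u \<le> exp u, used at \<open>v\<close> and at
  \<open>-v\<close>. The quadratic factor is what makes the error of a difference quotient vanish in
  the limit.\<close>

lemma exp_minus_one_minus_bound:
  fixes v :: real
  shows "\<bar>exp v - 1 - v\<bar> \<le> v\<^sup>2 * exp \<bar>v\<bar>"
proof -
  have 1: "exp v - 1 \<le> v * exp v" for v :: real
  proof -
    have "(1 - v) * exp v \<le> exp (-v) * exp v"
      using exp_ge_add_one_self[of "-v"] by (intro mult_right_mono) auto
    thus ?thesis by (simp add: algebra_simps flip: exp_add)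
  qed
  have lower: "exp v - 1 - v \<ge> 0" using exp_ge_add_one_self[of v] by linarith
  have "exp v - 1 - v \<le> v * (exp v - 1)" using 1[of v] by (simp add: algebra_simps)
  also have "\<dots> \<le> v\<^sup>2 * exp \<bar>v\<bar>"
  proof (cases "v \<ge> 0")
    case True
    thus ?thesis using mult_left_mono[OF 1[of v] True] by (simp add: power2_eq_square mult_ac)
  next
    case False
    have "(-v) * (1 - exp v) \<le> (-v) * (-v)"
      using False exp_ge_add_one_self[of v] by (intro mult_left_mono) linarith+
    also have "\<dots> \<le> (-v) * (-v) * exp (-v)"
      using False by (intro mult_left_mono[of 1 "exp (-v)", simplified]) auto
    finally show ?thesis using False by (simp add: power2_eq_square algebra_simps)
  qed
  finally show ?thesis using lower by simp
qed

text \<open>One term of the series of exp (y t) is at most its sum. The bound does not depend on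
  \<open>t\<close>, hence gives integrability over any finite measure.\<close>

lemma power_times_exp_minus_le:
  fixes y t :: real
  assumes "y > 0" "t \<ge> 0"
  shows "t ^ m * exp (- (y * t)) \<le> fact m / y ^ m"
proof -
  have sums: "(\<lambda>k. (y * t) ^ k /\<^sub>R fact k) sums exp (y * t)"
    by (rule exp_converges)
  have "sum (\<lambda>k. (y * t) ^ k /\<^sub>R fact k) {m} \<le> (\<Sum>k. (y * t) ^ k /\<^sub>R fact k)"
    using assms sums by (intro sum_le_suminf) (auto simp: sums_iff)
  hence "(y * t) ^ m / fact m \<le> exp (y * t)"
    using sums by (simp add: sums_iff divide_inverse mult.commute)
  hence "(y * t) ^ m \<le> fact m * exp (y * t)"
    by (simp add: pos_divide_le_eq mult.commute)
  hence "y ^ m * t ^ m / exp (y * t) \<le> fact m"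
    by (simp add: power_mult_distrib pos_divide_le_eq)
  thus ?thesis using assms by (simp add: exp_minus divide_inverse[symmetric] pos_le_divide_eq mult_ac)
qed

text \<open>For \<open>m = 0\<close> this is the Laplace transform of the image of \<open>M\<close>
  under \<open>T\<close>; higher \<open>m\<close> give its derivatives up to the sign
  (-1)^m.\<close>

definition laplace_moment :: "'a measure \<Rightarrow> ('a \<Rightarrow> real) \<Rightarrow> nat \<Rightarrow> real \<Rightarrow> real" where
  "laplace_moment M T m y = (\<integral>\<omega>. T \<omega> ^ m * exp (- (y * T \<omega>)) \<partial>M)"

lemma laplace_moment_nonneg:
  assumes "AE \<omega> in M. T \<omega> \<ge> 0"
  shows "laplace_moment M T m y \<ge> 0"
  unfolding laplace_moment_def using assms by (intro integral_nonneg_AE) auto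

context finite_measure
begin

lemma integrable_laplace_moment:
  fixes T :: "'a \<Rightarrow> real"
  assumes [measurable]: "T \<in> borel_measurable M" and T: "AE \<omega> in M. T \<omega> \<ge> 0" and "y > 0"
  shows "integrable M (\<lambda>\<omega>. T \<omega> ^ m * exp (- (y * T \<omega>)))"
proof (rule integrable_const_bound)
  show "AE \<omega> in M. norm (T \<omega> ^ m * exp (- (y * T \<omega>))) \<le> fact m / y ^ m"
    using T by eventually_elim (use power_times_exp_minus_le[OF \<open>y > 0\<close>] in auto)
qed measurable

text \<open>Differentiation under the integral sign with an explicit error: the difference quotient
  with increment h misses the claimed derivative by at most a constant times |h|.\<close>

lemma has_derivative_laplace_moment:
  assumes meas [measurable]: "T \<in> borel_measurable M" and T: "AE \<omega> in M. T \<omega> \<ge> 0" and "y > 0"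
  shows "(laplace_moment M T m has_real_derivative - laplace_moment M T (Suc m) y) (at y)"
proof -
  \<comment> \<open>The remainder bound contributes T^2 exp (|h| T). For |h| < y / 2 this raises the
    power to \<open>m + 2\<close> and still leaves decay at rate at least y / 2.\<close>
  define C where "C = laplace_moment M T (m + 2) (y / 2)"
  note int = integrable_laplace_moment[OF meas T]
  have bound: "norm ((laplace_moment M T m (y + h) - laplace_moment M T m y) / h
      + laplace_moment M T (Suc m) y) \<le> \<bar>h\<bar> * C" if h: "h \<noteq> 0" "\<bar>h\<bar> < y / 2" for h
  proof -
    \<comment> \<open>This is \<open>h\<close> times the integrand of the error; it factors as T^m
      exp (- y T) times the remainder of the linear approximation of exp at - h T.\<close>
    define E where "E \<omega> = T \<omega> ^ m * exp (- ((y + h) * T \<omega>)) - T \<omega> ^ m * exp (- (y * T \<omega>))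
           + h * (T \<omega> ^ Suc m * exp (- (y * T \<omega>)))" for \<omega>
    have y: "y + h > 0" "y / 2 > 0" using h \<open>y > 0\<close> by auto
    note ints = int[OF y(1), of m] int[OF \<open>y > 0\<close>, of m] int[OF \<open>y > 0\<close>, of "Suc m"] int[OF y(2), of "m + 2"]
    have E: "integrable M E"
      unfolding E_def by (intro Bochner_Integration.integrable_add Bochner_Integration.integrable_diff
        integrable_mult_right ints)
    have "laplace_moment M T m (y + h) - laplace_moment M T m y + h * laplace_moment M T (Suc m) y = (\<integral>\<omega>. E \<omega> \<partial>M)"
      unfolding laplace_moment_def E_def
      by (simp only: Bochner_Integration.integral_add Bochner_Integration.integral_diff
        Bochner_Integration.integrable_diff integrable_mult_right integral_mult_right_zero ints)
    also have "\<bar>\<dots>\<bar> \<le> (\<integral>\<omega>. \<bar>E \<omega>\<bar> \<partial>M)" by simp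
    also have "\<dots> \<le> (\<integral>\<omega>. h\<^sup>2 * (T \<omega> ^ (m + 2) * exp (- (y / 2 * T \<omega>))) \<partial>M)"
    proof (rule integral_mono_AE)
      show "AE \<omega> in M. \<bar>E \<omega>\<bar> \<le> h\<^sup>2 * (T \<omega> ^ (m + 2) * exp (- (y / 2 * T \<omega>)))"
        using T
      proof eventually_elim
        case (elim \<omega>)
        let ?t = "T \<omega>"
        have "E \<omega> = ?t ^ m * exp (- (y * ?t)) * (exp (- (h * ?t)) - 1 - (- (h * ?t)))"
          unfolding E_def by (simp add: algebra_simps exp_add[symmetric])
        also have "\<bar>\<dots>\<bar> = ?t ^ m * exp (- (y * ?t)) * \<bar>exp (- (h * ?t)) - 1 - (- (h * ?t))\<bar>"
          using elim by (simp add: abs_mult)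
        also have "\<dots> \<le> ?t ^ m * exp (- (y * ?t)) * ((- (h * ?t))\<^sup>2 * exp \<bar>- (h * ?t)\<bar>)"
          using elim by (intro mult_left_mono exp_minus_one_minus_bound) auto
        also have "\<dots> = h\<^sup>2 * (?t ^ (m + 2) * exp ((\<bar>h\<bar> - y) * ?t))"
          using elim by (simp add: power_mult_distrib power_add abs_mult algebra_simps exp_diff exp_minus divide_inverse power2_eq_square)
        also have "\<dots> \<le> h\<^sup>2 * (?t ^ (m + 2) * exp ((- (y / 2)) * ?t))"
          using elim h by (intro mult_left_mono iffD2[OF exp_le_cancel_iff] mult_right_mono) auto
        finally show ?case by simp
      qed
    qed (use E ints in auto)
    also have "\<dots> = h\<^sup>2 * C" unfolding C_def laplace_moment_def by simp
    finally have *: "\<bar>laplace_moment M T m (y + h) - laplace_moment M T m y + h * laplace_moment M T (Suc m) y\<bar> \<le> h\<^sup>2 * C" .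
    have "(laplace_moment M T m (y + h) - laplace_moment M T m y) / h + laplace_moment M T (Suc m) y
      = (laplace_moment M T m (y + h) - laplace_moment M T m y + h * laplace_moment M T (Suc m) y) / h"
      using h by (simp add: add_divide_distrib)
    also have "norm \<dots> \<le> h\<^sup>2 * C / \<bar>h\<bar>"
      unfolding real_norm_def abs_divide using * by (rule divide_right_mono) simp
    also have "\<dots> = \<bar>h\<bar> * C"
      using h by (cases "h > 0") (auto simp: power2_eq_square)
    finally show ?thesis .
  qed
  have "((\<lambda>h. (laplace_moment M T m (y + h) - laplace_moment M T m y) / h + laplace_moment M T (Suc m) y)
     \<longlongrightarrow> 0) (at 0)"
  proof (rule Lim_null_comparison)
    show "\<forall>\<^sub>F h in at 0. norm ((laplace_moment M T m (y + h) - laplace_moment M T m y) / h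
      + laplace_moment M T (Suc m) y) \<le> \<bar>h\<bar> * C"
      unfolding eventually_at using bound \<open>y > 0\<close>
      by (intro exI[of _ "y / 2"]) (auto simp: dist_real_def)
    show "((\<lambda>h. \<bar>h\<bar> * C) \<longlongrightarrow> 0) (at 0)" by (auto intro!: tendsto_eq_intros)
  qed
  from tendsto_diff[OF this tendsto_const[of "laplace_moment M T (Suc m) y"]]
  show ?thesis by (simp add: DERIV_def)
qed

text \<open>The endpoint 0 is included, which differentiability on the open half-line does not
  cover. The constant 1 dominates all integrands.\<close>

lemma continuous_on_laplace_moment_0:
  assumes [measurable]: "T \<in> borel_measurable M" and T: "AE \<omega> in M. T \<omega> \<ge> 0"
  shows "continuous_on {0..} (laplace_moment M T 0)"
  unfolding continuous_on_sequentially comp_def laplace_moment_def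
proof safe
  fix X :: "nat \<Rightarrow> real" and y assume X: "\<forall>n. X n \<in> {0..}" "X \<longlonglongrightarrow> y"
  show "(\<lambda>n. \<integral>\<omega>. T \<omega> ^ 0 * exp (- (X n * T \<omega>)) \<partial>M) \<longlonglongrightarrow> (\<integral>\<omega>. T \<omega> ^ 0 * exp (- (y * T \<omega>)) \<partial>M)"
  proof (rule integral_dominated_convergence[where w = "\<lambda>_. 1"])
    show "AE \<omega> in M. norm (T \<omega> ^ 0 * exp (- (X n * T \<omega>))) \<le> 1" for n
      using T by eventually_elim (use X in auto)
    show "AE \<omega> in M. (\<lambda>n. T \<omega> ^ 0 * exp (- (X n * T \<omega>))) \<longlonglongrightarrow> T \<omega> ^ 0 * exp (- (y * T \<omega>))"
      using X by (intro AE_I2 tendsto_intros)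
  qed auto
qed

end

section \<open>Gamma and arcsine distributions and their moments\<close>

definition gamma_measure :: "real \<Rightarrow> real measure" where
  "gamma_measure a = density lborel (\<lambda>t. indicator {0..} t * t powr (a - 1) / exp t / Gamma a)"

text \<open>This is the Beta distribution with both parameters 1/2, whose normalising constant is
  Beta (1/2, 1/2) = pi.\<close>

definition arcsine_measure :: "real measure" where
  "arcsine_measure = density lborel
     (\<lambda>t. indicator {0..1} t * (t powr (- 1 / 2) * (1 - t) powr (- 1 / 2)) / pi)"

lemma sets_gamma_measure [measurable_cong, simp]: "sets (gamma_measure a) = sets borel"
  and space_gamma_measure [simp]: "space (gamma_measure a) = UNIV"
  by (simp_all add: gamma_measure_def)

lemma sets_arcsine_measure [measurable_cong, simp]: "sets arcsine_measure = sets borel"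
  and space_arcsine_measure [simp]: "space arcsine_measure = UNIV"
  by (simp_all add: arcsine_measure_def)

text \<open>Rescaling by 1 + y turns the integral into Gamma (a + k), and Gamma (a + k) / Gamma a is
  the Pochhammer symbol. Multiplied by y^k / k!, the result is a basis function.\<close>

lemma gamma_measure_moment:
  assumes "a > 0" "y \<ge> 0"
  shows "(\<integral>\<^sup>+t. ennreal (exp (- (y * t)) * t ^ k) \<partial>gamma_measure a) =
           ennreal (pochhammer a k * (1 + y) powr (- a - real k))"
proof -
  have Ga: "Gamma a > 0" using assms by simp
  have [simp]: "a + real k > 0" "1 + y > 0" using assms by auto
  define s where "s = a + real k"
  let ?g = "\<lambda>t. indicator {0..} t * t powr (s - 1) / exp t :: real"
  \<comment> \<open>Euler's integral after the substitution of (1 + y) t for t; the leading factor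
    is the Jacobian.\<close>
  have Gamma_s: "ennreal (Gamma s) = ennreal (1 + y) * (\<integral>\<^sup>+t. ennreal (?g ((1 + y) * t)) \<partial>lborel)"
    unfolding Gamma_conv_nn_integral_real[OF \<open>a + real k > 0\<close>, folded s_def]
    using assms by (subst nn_integral_real_affine[where c = "1 + y" and t = 0]) (auto simp: abs_of_nonneg)
  have scaled: "(\<integral>\<^sup>+t. ennreal (?g ((1 + y) * t)) \<partial>lborel) = ennreal (Gamma s / (1 + y))"
  proof -
    have "ennreal (Gamma s / (1 + y)) = ennreal (1 / (1 + y)) * ennreal (Gamma s)"
      using assms by (subst ennreal_mult'[symmetric]) (simp_all add: add_nonneg_nonneg)
    also have "\<dots> = ennreal (1 / (1 + y) * (1 + y)) * (\<integral>\<^sup>+t. ennreal (?g ((1 + y) * t)) \<partial>lborel)"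
      unfolding Gamma_s by (subst ennreal_mult''[OF less_imp_le[OF \<open>1 + y > 0\<close>]]) (simp only: mult.assoc)
    finally show ?thesis using \<open>1 + y > 0\<close> by simp
  qed
  have "(\<integral>\<^sup>+t. ennreal (exp (- (y * t)) * t ^ k) \<partial>gamma_measure a) =
     (\<integral>\<^sup>+t. ennreal (indicator {0..} t * t powr (a - 1) / exp t / Gamma a) * ennreal (exp (- (y * t)) * t ^ k) \<partial>lborel)"
    unfolding gamma_measure_def by (intro nn_integral_density) auto
  also have "\<dots> = (\<integral>\<^sup>+t. ennreal ((1 + y) powr (1 - s) / Gamma a) * ennreal (?g ((1 + y) * t)) \<partial>lborel)"
  proof (rule nn_integral_cong_AE, rule AE_mp[OF AE_lborel_singleton[of 0]], rule AE_I2, rule impI)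
    \<comment> \<open>With the null set t = 0 removed, the powers combine for t > 0 and both sides
      vanish for t < 0.\<close>
    fix t :: real assume "t \<noteq> 0"
    show "ennreal (indicator {0..} t * t powr (a - 1) / exp t / Gamma a) * ennreal (exp (- (y * t)) * t ^ k)
       = ennreal ((1 + y) powr (1 - s) / Gamma a) * ennreal (?g ((1 + y) * t))"
    proof (cases "t > 0")
      case True
      have "t powr (a - 1) * t ^ k = t powr (s - 1)"
        using True by (simp add: s_def powr_realpow[symmetric] powr_add[symmetric] algebra_simps)
      moreover have "(1 + y) powr (1 - s) * ((1 + y) * t) powr (s - 1) = t powr (s - 1)"
      proof -
        have "(1 + y) powr (1 - s) * (1 + y) powr (s - 1) = 1"
          using assms by (simp flip: powr_add)
        thus ?thesis using assms True by (simp add: powr_mult mult.assoc[symmetric])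
      qed
      moreover have "exp ((1 + y) * t) = exp t * exp (y * t)" by (simp add: algebra_simps exp_add)
      ultimately have "t powr (a - 1) / exp t / Gamma a * (exp (- (y * t)) * t ^ k) =
          (1 + y) powr (1 - s) / Gamma a * (((1 + y) * t) powr (s - 1) / exp ((1 + y) * t))"
        by (simp add: exp_minus divide_inverse mult_ac)
      thus ?thesis using True assms Ga
        by (subst (1 2) ennreal_mult[symmetric]) auto
    next
      case False
      hence "\<not> (1 + y) * t \<ge> 0" using \<open>t \<noteq> 0\<close> by (simp add: zero_le_mult_iff not_le)
      thus ?thesis using False \<open>t \<noteq> 0\<close> by simp
    qed
  qed
  also have "\<dots> = ennreal ((1 + y) powr (1 - s) / Gamma a) * (\<integral>\<^sup>+t. ennreal (?g ((1 + y) * t)) \<partial>lborel)"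
    by (intro nn_integral_cmult) auto
  also note scaled
  also have "ennreal ((1 + y) powr (1 - s) / Gamma a) * ennreal (Gamma s / (1 + y)) = ennreal (pochhammer a k * (1 + y) powr (- a - real k))"
  proof -
    have "pochhammer a k = Gamma s / Gamma a"
      unfolding s_def using assms by (intro pochhammer_Gamma) (auto dest: nonpos_Ints_nonpos)
    moreover have "(1 + y) powr (1 - s) / (1 + y) = (1 + y) powr (- a - real k)"
      using assms powr_add[of "1 + y" "- a - real k" 1] by (simp add: s_def field_simps)
    moreover have "(1 + y) powr (1 - s) / Gamma a * (Gamma s / (1 + y)) =
        Gamma s / Gamma a * ((1 + y) powr (1 - s) / (1 + y))" by simp
    ultimately have "(1 + y) powr (1 - s) / Gamma a * (Gamma s / (1 + y)) =
        pochhammer a k * (1 + y) powr (- a - real k)" by simp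
    thus ?thesis using Ga by (subst ennreal_mult'[symmetric]) simp_all
  qed
  finally show ?thesis .
qed

text \<open>The moments are values of the Beta function. Their Pochhammer factor is the one that
  cancels in the series of cosh, leaving the coefficients 1 / (k!)^2 of the Bessel function.\<close>

lemma arcsine_measure_moment:
  "(\<integral>\<^sup>+t. ennreal (t ^ k) \<partial>arcsine_measure) = ennreal (pochhammer (1 / 2) k / fact k)"
proof -
  have "((\<lambda>t. t powr (real k + 1 / 2 - 1) * (1 - t) powr (1 / 2 - 1)) has_integral Beta (real k + 1 / 2) (1 / 2)) {0..1}"
    by (intro has_integral_Beta_real) auto
  from nn_integral_has_integral_lebesgue[OF _ this]
  have B: "(\<integral>\<^sup>+t. ennreal (indicator {0..1} t * (t powr (real k + 1 / 2 - 1) * (1 - t) powr (1 / 2 - 1))) \<partial>lborel) =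
      ennreal (Beta (real k + 1 / 2) (1 / 2))" by simp
  have "(\<integral>\<^sup>+t. ennreal (t ^ k) \<partial>arcsine_measure) =
      (\<integral>\<^sup>+t. ennreal (indicator {0..1} t * (t powr (- 1 / 2) * (1 - t) powr (- 1 / 2)) / pi) * ennreal (t ^ k) \<partial>lborel)"
    unfolding arcsine_measure_def by (intro nn_integral_density) auto
  also have "\<dots> = (\<integral>\<^sup>+t. ennreal (1 / pi) *
     ennreal (indicator {0..1} t * (t powr (real k + 1 / 2 - 1) * (1 - t) powr (1 / 2 - 1))) \<partial>lborel)"
  proof (rule nn_integral_cong_AE, rule AE_mp[OF AE_lborel_singleton[of 0]], rule AE_I2, rule impI)
    fix t :: real assume "t \<noteq> 0"
    show "ennreal (indicator {0..1} t * (t powr (- 1 / 2) * (1 - t) powr (- 1 / 2)) / pi) * ennreal (t ^ k) =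
      ennreal (1 / pi) * ennreal (indicator {0..1} t * (t powr (real k + 1 / 2 - 1) * (1 - t) powr (1 / 2 - 1)))"
    proof (cases "t \<in> {0..1}")
      case True
      hence "t ^ k * t powr (- 1 / 2) = t powr (real k + 1 / 2 - 1)"
        using \<open>t \<noteq> 0\<close> by (simp add: powr_realpow[symmetric] powr_add[symmetric])
      thus ?thesis using True
        by (subst (1 2) ennreal_mult[symmetric])
           (auto simp: mult_ac intro!: arg_cong[where f = ennreal])
    qed simp
  qed
  also have "\<dots> = ennreal (1 / pi) * ennreal (Beta (real k + 1 / 2) (1 / 2))"
    by (subst nn_integral_cmult) (simp_all only: B, measurable)
  also have "\<dots> = ennreal (1 / pi * Beta (real k + 1 / 2) (1 / 2))"
    by (subst ennreal_mult'') (auto simp: Beta_def)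
  also have "1 / pi * Beta (real k + 1 / 2) (1 / 2) = pochhammer (1 / 2) k / fact k"
  proof -
    have "pochhammer (1 / 2 :: real) k = Gamma (1 / 2 + real k) / Gamma (1 / 2)"
      by (intro pochhammer_Gamma) (auto dest: nonpos_Ints_nonpos)
    hence "Gamma (real k + 1 / 2) = sqrt pi * pochhammer (1 / 2) k"
      by (simp add: Gamma_one_half_real add.commute field_simps)
    moreover have "Gamma (real k + 1 / 2 + 1 / 2) = fact k"
      using Gamma_fact[of k, where 'a = real] by (simp add: add.commute)
    ultimately show ?thesis
      unfolding Beta_def by (simp only: Gamma_one_half_real) (simp add: field_simps)
  qed
  finally show ?thesis .
qed

lemma finite_measure_gamma_measure:
  assumes "a > 0" shows "finite_measure (gamma_measure a)"
  using gamma_measure_moment[OF assms, of 0 0] by (intro finite_measureI) simp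

lemma finite_measure_arcsine_measure: "finite_measure arcsine_measure"
  using arcsine_measure_moment[of 0] by (intro finite_measureI) simp

lemma AE_gamma_measure: "AE t in gamma_measure a. t \<ge> 0"
  unfolding gamma_measure_def by (subst AE_density) (auto simp: indicator_def)

lemma AE_arcsine_measure: "AE t in arcsine_measure. t \<in> {0..1}"
  unfolding arcsine_measure_def by (subst AE_density) (auto simp: indicator_def)

section \<open>The product measure and the summation over k\<close>

lemma nn_integral_times_pair:
  assumes "sigma_finite_measure N" and [measurable]: "f \<in> borel_measurable M" "g \<in> borel_measurable N"
  shows "(\<integral>\<^sup>+z. f (fst z) * g (snd z) \<partial>(M \<Otimes>\<^sub>M N)) = (\<integral>\<^sup>+x. f x \<partial>M) * (\<integral>\<^sup>+y. g y \<partial>N)"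
proof -
  have "(\<integral>\<^sup>+z. f (fst z) * g (snd z) \<partial>(M \<Otimes>\<^sub>M N)) = (\<integral>\<^sup>+x. \<integral>\<^sup>+y. f x * g y \<partial>N \<partial>M)"
    by (subst sigma_finite_measure.nn_integral_fst[OF assms(1), symmetric]) auto
  thus ?thesis by (simp add: nn_integral_cmult nn_integral_multc)
qed

text \<open>The duplication formula (2k)! = 4^k (1/2)_k k! rewrites the even terms of the series;
  the powers of 4 cancel against the argument 2 sqrt w.\<close>

lemma cosh_double_sqrt_sums:
  fixes w :: real
  assumes "w \<ge> 0"
  shows "(\<lambda>k. w ^ k / (pochhammer (1 / 2) k * fact k)) sums cosh (2 * sqrt w)"
proof -
  \<comment> \<open>The cosh series runs over all indices with zeros at the odd ones; reindexing
    along k to 2k drops those.\<close>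
  have "(\<lambda>k. if even (2 * k) then (2 * sqrt w) ^ (2 * k) /\<^sub>R fact (2 * k) else 0) sums cosh (2 * sqrt w)"
    using cosh_converges[of "2 * sqrt w"]
    by (subst sums_mono_reindex) (auto simp: strict_mono_def elim!: evenE)
  moreover have "(2 * sqrt w) ^ (2 * k) /\<^sub>R fact (2 * k) = w ^ k / (pochhammer (1 / 2) k * fact k)" for k
  proof -
    have "(2 * sqrt w) ^ (2 * k) = 2 ^ (2 * k) * (sqrt w ^ 2) ^ k"
      by (simp only: power_mult_distrib power_mult)
    hence "(2 * sqrt w) ^ (2 * k) /\<^sub>R fact (2 * k) =
        (2 ^ (2 * k) * w ^ k) / (2 ^ (2 * k) * (pochhammer (1 / 2) k * fact k))"
      unfolding fact_double real_sqrt_pow2[OF assms] real_scaleR_def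
      by (simp only: divide_inverse mult_ac)
    thus ?thesis by (simp only: mult_divide_mult_cancel_left power_not_zero zero_neq_numeral[symmetric] not_False_eq_True)
  qed
  ultimately show ?thesis by simp
qed

text \<open>One Gamma variable serves each factor of the squared basis function; the arcsine
  variable represents the Bessel function.\<close>

definition mixing_measure :: "real \<Rightarrow> (real \<times> real \<times> real) measure" where
  "mixing_measure a = gamma_measure a \<Otimes>\<^sub>M (gamma_measure a \<Otimes>\<^sub>M arcsine_measure)"

lemma sets_mixing_measure [measurable_cong, simp]:
  "sets (mixing_measure a) = sets (borel \<Otimes>\<^sub>M (borel \<Otimes>\<^sub>M borel))"
  unfolding mixing_measure_def by (intro sets_pair_measure_cong) auto

lemma space_mixing_measure [simp]: "space (mixing_measure a) = UNIV"
  by (simp add: mixing_measure_def space_pair_measure)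

lemma sigma_finite_arcsine_measure: "sigma_finite_measure arcsine_measure"
  by (intro finite_measure.axioms(1) finite_measure_arcsine_measure)

lemma sigma_finite_gamma_measure: "a > 0 \<Longrightarrow> sigma_finite_measure (gamma_measure a)"
  by (intro finite_measure.axioms(1) finite_measure_gamma_measure)

lemma sigma_finite_gamma_arcsine:
  assumes "a > 0"
  shows "sigma_finite_measure (gamma_measure a \<Otimes>\<^sub>M arcsine_measure)"
  by (intro sigma_finite_pair_measure sigma_finite_gamma_measure sigma_finite_arcsine_measure assms)

lemma nn_integral_mixing_measure:
  assumes a: "a > 0" and [measurable]: "f \<in> borel_measurable borel" "g \<in> borel_measurable borel" "h \<in> borel_measurable borel"
  shows "(\<integral>\<^sup>+(l, m, t). f l * (g m * h t) \<partial>mixing_measure a) =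
     (\<integral>\<^sup>+l. f l \<partial>gamma_measure a) * ((\<integral>\<^sup>+m. g m \<partial>gamma_measure a) * (\<integral>\<^sup>+t. h t \<partial>arcsine_measure))"
  unfolding mixing_measure_def case_prod_beta
  using nn_integral_times_pair[OF sigma_finite_gamma_arcsine[OF a], of f "gamma_measure a" "\<lambda>z. g (fst z) * h (snd z)"]
    nn_integral_times_pair[OF sigma_finite_arcsine_measure, of g "gamma_measure a" h]
  by simp

text \<open>The underlying space is all of R^3, so the signs needed under the square roots come from
  the supports of the densities and hold only almost everywhere.\<close>

lemma AE_mixing_measure:
  assumes "a > 0"
  shows "AE (l, m, t) in mixing_measure a. l \<ge> 0 \<and> m \<ge> 0 \<and> t \<in> {0..1}"
proof -
  have inner: "AE (m, t) in gamma_measure a \<Otimes>\<^sub>M arcsine_measure. m \<ge> 0 \<and> t \<in> {0..1}"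
  proof (rule pair_sigma_finite.AE_pair_measure[OF pair_sigma_finite.intro
        [OF sigma_finite_gamma_measure[OF assms] sigma_finite_arcsine_measure]])
    show "AE x in gamma_measure a. AE y in arcsine_measure. case (x, y) of (m, t) \<Rightarrow> m \<ge> 0 \<and> t \<in> {0..1}"
      using AE_gamma_measure by eventually_elim (use AE_arcsine_measure in auto)
  qed measurable
  show ?thesis
    unfolding mixing_measure_def
  proof (rule pair_sigma_finite.AE_pair_measure[OF pair_sigma_finite.intro
        [OF sigma_finite_gamma_measure[OF assms] sigma_finite_gamma_arcsine[OF assms]]])
    show "AE x in gamma_measure a. AE y in gamma_measure a \<Otimes>\<^sub>M arcsine_measure.
       case (x, y) of (l, m, t) \<Rightarrow> l \<ge> 0 \<and> m \<ge> 0 \<and> t \<in> {0..1}"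
      using AE_gamma_measure by eventually_elim (use inner in auto)
  qed measurable
qed

lemma finite_measure_mixing_measure:
  assumes "a > 0"
  shows "finite_measure (mixing_measure a)"
  using nn_integral_mixing_measure[OF assms, of "\<lambda>_. 1" "\<lambda>_. 1" "\<lambda>_. 1"]
    gamma_measure_moment[OF assms, of 0 0] arcsine_measure_moment[of 0]
  by (intro finite_measureI) (simp add: case_prod_unfold)

text \<open>After expanding cosh, each term is a product of functions of \<open>l\<close>,
  \<open>m\<close> and \<open>t\<close>, so its integral is a product of known moments. Nonnegative
  integrals permit the exchange with the sum before any convergence is known.\<close>

lemma nn_integral_mixing_cosh:
  assumes a: "a > 0" and y: "y \<ge> 0"
  shows "(\<integral>\<^sup>+(l, m, t). ennreal (exp (- (y * (l + m))) * cosh (2 * y * sqrt (l * m * t))) \<partial>mixing_measure a) =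
     (\<Sum>k. ennreal ((pochhammer a k / fact k * y ^ k * (1 + y) powr (- a - real k))\<^sup>2))"
proof -
  \<comment> \<open>The coefficient of (l m t)^k in the expansion of cosh (2 y sqrt (l m
    t)).\<close>
  define w where "w k = (y\<^sup>2) ^ k / (pochhammer (1 / 2) k * fact k)" for k
  have w: "w k \<ge> 0" for k
    unfolding w_def by (intro divide_nonneg_nonneg mult_nonneg_nonneg pochhammer_nonneg) auto
  define e where "e k l = ennreal (exp (- (y * l)) * l ^ k)" for k and l :: real
  have [measurable]: "e k \<in> borel_measurable borel" for k unfolding e_def by measurable
  have "(\<integral>\<^sup>+(l, m, t). ennreal (exp (- (y * (l + m))) * cosh (2 * y * sqrt (l * m * t))) \<partial>mixing_measure a) =
     (\<integral>\<^sup>+z. (\<Sum>k. ennreal (w k) * (case z of (l, m, t) \<Rightarrow> e k l * (e k m * ennreal (t ^ k)))) \<partial>mixing_measure a)"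
  proof (rule nn_integral_cong_AE)
    show "AE z in mixing_measure a.
       (case z of (l, m, t) \<Rightarrow> ennreal (exp (- (y * (l + m))) * cosh (2 * y * sqrt (l * m * t)))) =
       (\<Sum>k. ennreal (w k) * (case z of (l, m, t) \<Rightarrow> e k l * (e k m * ennreal (t ^ k))))"
      using AE_mixing_measure[OF a]
    proof eventually_elim
      case (elim z)
      obtain l m t where z: "z = (l, m, t)" by (cases z)
      have nn: "l \<ge> 0" "m \<ge> 0" "t \<ge> 0" using elim z by auto
      let ?E = "exp (- (y * (l + m)))"
      define v where "v = y\<^sup>2 * (l * m * t)"
      have v: "v \<ge> 0" "y * sqrt (l * m * t) = sqrt v"
        using nn y by (auto simp: v_def real_sqrt_mult)
      have E: "?E = exp (- (y * l)) * exp (- (y * m))"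
        by (simp add: distrib_left flip: exp_add)
      have sums: "(\<lambda>k. ?E * (v ^ k / (pochhammer (1 / 2) k * fact k))) sums (?E * cosh (2 * sqrt v))"
        by (intro sums_mult cosh_double_sqrt_sums v)
      have "ennreal (w k) * (e k l * (e k m * ennreal (t ^ k))) =
              ennreal (?E * (v ^ k / (pochhammer (1 / 2) k * fact k)))" for k
      proof -
        have "ennreal (w k) * (e k l * (e k m * ennreal (t ^ k))) =
           ennreal (w k * ((exp (- (y * l)) * l ^ k) * ((exp (- (y * m)) * m ^ k) * t ^ k)))"
          unfolding e_def using nn w by (simp add: ennreal_mult)
        also have "w k * ((exp (- (y * l)) * l ^ k) * ((exp (- (y * m)) * m ^ k) * t ^ k)) =
           ?E * (v ^ k / (pochhammer (1 / 2) k * fact k))"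
          unfolding w_def v_def E by (simp add: power_mult_distrib mult_ac)
        finally show ?thesis .
      qed
      moreover have "(\<Sum>k. ennreal (?E * (v ^ k / (pochhammer (1 / 2) k * fact k)))) = ennreal (?E * cosh (2 * sqrt v))"
        using sums v
        by (subst suminf_ennreal2)
           (auto simp: sums_iff intro!: mult_nonneg_nonneg divide_nonneg_nonneg pochhammer_nonneg)
      ultimately show ?case using v(2) by (simp add: z mult.assoc)
    qed
  qed
  also have "\<dots> = (\<Sum>k. \<integral>\<^sup>+z. ennreal (w k) * (case z of (l, m, t) \<Rightarrow> e k l * (e k m * ennreal (t ^ k))) \<partial>mixing_measure a)"
    by (intro nn_integral_suminf) measurable
  also have "\<dots> = (\<Sum>k. ennreal ((pochhammer a k / fact k * y ^ k * (1 + y) powr (- a - real k))\<^sup>2))"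
  proof (rule suminf_cong)
    fix k
    let ?G = "pochhammer a k * (1 + y) powr (- a - real k)"
    have P: "pochhammer a k \<ge> 0" "pochhammer (1 / 2 :: real) k > 0"
      using a by (auto intro!: pochhammer_nonneg pochhammer_pos)
    have "(\<integral>\<^sup>+z. ennreal (w k) * (case z of (l, m, t) \<Rightarrow> e k l * (e k m * ennreal (t ^ k))) \<partial>mixing_measure a) =
       ennreal (w k) * (\<integral>\<^sup>+(l, m, t). e k l * (e k m * ennreal (t ^ k)) \<partial>mixing_measure a)"
      by (intro nn_integral_cmult) measurable
    also have "(\<integral>\<^sup>+(l, m, t). e k l * (e k m * ennreal (t ^ k)) \<partial>mixing_measure a) =
       ennreal ?G * (ennreal ?G * ennreal (pochhammer (1 / 2) k / fact k))"
      by (subst nn_integral_mixing_measure[OF a])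
         (simp_all only: gamma_measure_moment[OF a y, folded e_def] arcsine_measure_moment, measurable)
    also have "ennreal (w k) * \<dots> = ennreal (w k * (?G * (?G * (pochhammer (1 / 2) k / fact k))))"
      using P w a by (simp del: times_divide_eq_right flip: ennreal_mult)
    \<comment> \<open>The arcsine moment cancels \<open>pochhammer (1 / 2) k\<close> in
      \<open>w k\<close> and supplies a second 1 / k!, which completes the square.\<close>
    also have "w k * (?G * (?G * (pochhammer (1 / 2) k / fact k))) =
       (pochhammer a k / fact k * y ^ k * (1 + y) powr (- a - real k))\<^sup>2"
      using P(2) by (simp add: w_def power2_eq_square power_mult_distrib field_simps)
    finally show "(\<integral>\<^sup>+z. ennreal (w k) * (case z of (l, m, t) \<Rightarrow> e k l * (e k m * ennreal (t ^ k))) \<partial>mixing_measure a) =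
       ennreal ((pochhammer a k / fact k * y ^ k * (1 + y) powr (- a - real k))\<^sup>2)" .
  qed
  finally show ?thesis .
qed

section \<open>The exponents and the Laplace representation of the sum of squares\<close>

text \<open>The values 1 and -1 of \<open>s\<close> give the two exponentials of cosh. The factor
  \<open>c\<close> is included so that the Laplace variable is \<open>x\<close> itself and not c
  x.\<close>

definition exponent :: "real \<Rightarrow> real \<Rightarrow> real \<times> real \<times> real \<Rightarrow> real" where
  "exponent c s = (\<lambda>(l, m, t). c * (l + m + s * (2 * sqrt (l * m * t))))"

text \<open>Since t \<le> 1 and |s| \<le> 1, the root term is at most 2 sqrt (l m), which AM-GM
  bounds by l + m.\<close>

lemma exponent_nonneg:
  assumes "a > 0" "c > 0" "\<bar>s\<bar> \<le> 1"
  shows "AE z in mixing_measure a. exponent c s z \<ge> 0"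
  using AE_mixing_measure[OF assms(1)]
proof eventually_elim
  case (elim z)
  obtain l m t where z: "z = (l, m, t)" by (cases z)
  have nn: "l \<ge> 0" "m \<ge> 0" "0 \<le> t" "t \<le> 1" using elim z by auto
  have "\<bar>s\<bar> * (2 * sqrt (l * m * t)) \<le> 1 * (2 * sqrt (l * m))"
    using nn assms by (intro mult_mono) (auto simp: mult_left_le)
  also have "\<dots> \<le> l + m"
    using arith_geo_mean_sqrt[of l m] nn by simp
  finally have "\<bar>s * (2 * sqrt (l * m * t))\<bar> \<le> l + m"
    using nn by (simp add: abs_mult)
  thus ?case using assms by (simp add: exponent_def z)
qed

lemma measurable_exponent [measurable]: "exponent c s \<in> borel_measurable (mixing_measure a)"
  unfolding exponent_def by measurable

text \<open>The sign (-1)^k from the binomial coefficient with negative upper entry cancels the one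
  in (- c x)^k.\<close>

lemma baskakov_basis_eq:
  assumes "c > 0"
  shows "baskakov_basis c n k x =
    pochhammer (real n / c) k / fact k * (c * x) ^ k * (1 + c * x) powr (- (real n / c) - real k)"
proof -
  have "(- c * x) ^ k = (-1) ^ k * (c * x) ^ k" by (simp flip: power_mult_distrib)
  thus ?thesis by (simp add: baskakov_basis_def gbinomial_pochhammer flip: power_mult_distrib)
qed

text \<open>The identity is first proved in the extended nonnegative reals; finiteness of its
  right-hand side then yields convergence as well as the value.\<close>

lemma baskakov_sums:
  assumes n: "n > 0" and c: "c > 0" and x: "x \<ge> 0"
  defines "L \<equiv> (\<lambda>s. laplace_moment (mixing_measure (real n / c)) (exponent c s) 0 x)"
  shows "(\<lambda>k. (baskakov_basis c n k x)\<^sup>2) sums ((L 1 + L (-1)) / 2)"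
proof -
  define a where "a = real n / c"
  have a: "a > 0" using n c by (simp add: a_def)
  interpret finite_measure "mixing_measure a" using a by (rule finite_measure_mixing_measure)
  let ?F = "\<lambda>s z. exp (- (x * exponent c s z))"
  have L_eq: "L s = (\<integral>z. ?F s z \<partial>mixing_measure a)" for s
    by (simp add: L_def laplace_moment_def a_def)
  have int: "integrable (mixing_measure a) (?F s)" if "\<bar>s\<bar> \<le> 1" for s
  proof (rule integrable_const_bound)
    show "AE z in mixing_measure a. norm (?F s z) \<le> 1"
      using exponent_nonneg[OF a c that] by eventually_elim (use x in auto)
  qed measurable
  have "(\<Sum>k. ennreal ((baskakov_basis c n k x)\<^sup>2)) =
     (\<integral>\<^sup>+(l, m, t). ennreal (exp (- (c * x * (l + m))) * cosh (2 * (c * x) * sqrt (l * m * t))) \<partial>mixing_measure a)"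
    unfolding baskakov_basis_eq[OF c] a_def[symmetric]
    using c x by (intro nn_integral_mixing_cosh[OF a, symmetric]) simp
  also have "\<dots> = (\<integral>\<^sup>+z. ennreal ((?F 1 z + ?F (-1) z) / 2) \<partial>mixing_measure a)"
  proof (intro nn_integral_cong, clarify)
    fix l m t :: real
    \<comment> \<open>\<open>x\<close> times the two exponents is P + r and P - r, so the mean of
      the exponentials is exp (- P) cosh r.\<close>
    define P r where "P = c * x * (l + m)" and "r = 2 * (c * x) * sqrt (l * m * t)"
    have "x * exponent c s (l, m, t) = P + s * r" for s
      by (simp add: exponent_def P_def r_def algebra_simps)
    hence "(?F 1 (l, m, t) + ?F (-1) (l, m, t)) / 2 = (exp (- (P + 1 * r)) + exp (- (P + (-1) * r))) / 2"
      by (simp only:)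
    also have "\<dots> = exp (- P) * cosh r"
      by (simp add: cosh_field_def distrib_left flip: exp_add)
    finally show "ennreal (exp (- (c * x * (l + m))) * cosh (2 * (c * x) * sqrt (l * m * t))) =
        ennreal ((?F 1 (l, m, t) + ?F (-1) (l, m, t)) / 2)"
      by (simp only: P_def r_def)
  qed
  also have "\<dots> = ennreal (\<integral>z. (?F 1 z + ?F (-1) z) / 2 \<partial>mixing_measure a)"
    using int by (intro nn_integral_eq_integral) auto
  also have "(\<integral>z. (?F 1 z + ?F (-1) z) / 2 \<partial>mixing_measure a) = (L 1 + L (-1)) / 2"
    using int by (simp add: L_eq)
  finally have eq: "(\<Sum>k. ennreal ((baskakov_basis c n k x)\<^sup>2)) = ennreal ((L 1 + L (-1)) / 2)" .
  have L: "L s \<ge> 0" if "\<bar>s\<bar> \<le> 1" for s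
    unfolding L_def a_def[symmetric] by (intro laplace_moment_nonneg exponent_nonneg a c that)
  have summable: "summable (\<lambda>k. (baskakov_basis c n k x)\<^sup>2)"
    by (rule summable_suminf_not_top) (auto simp: eq)
  moreover have "(\<Sum>k. (baskakov_basis c n k x)\<^sup>2) = (L 1 + L (-1)) / 2"
    using eq summable L[of 1] L[of "-1"] by (simp add: suminf_ennreal2 suminf_nonneg)
  ultimately show ?thesis by (simp add: sums_iff)
qed

theorem theorem2p2:
  fixes n :: nat and c :: real
  assumes "n > 0" and "c > 0"
  shows "(\<forall>x\<ge>0. summable (\<lambda>k. (baskakov_basis c n k x)\<^sup>2)) \<and>
         completely_monotonic (baskakov_psi n c)"
proof
  show "\<forall>x\<ge>0. summable (\<lambda>k. (baskakov_basis c n k x)\<^sup>2)"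
    using baskakov_sums[OF assms] sums_summable by blast
  define a where "a = real n / c"
  have a: "a > 0" using assms by (simp add: a_def)
  interpret finite_measure "mixing_measure a" using a by (rule finite_measure_mixing_measure)
  \<comment> \<open>By the cosh splitting, \<open>g 0\<close> is the sum of squares for x \<ge> 0;
    \<open>g m\<close> for larger \<open>m\<close> follows by differentiating both
    transforms.\<close>
  define g where "g m x = (laplace_moment (mixing_measure a) (exponent c 1) m x + laplace_moment (mixing_measure a) (exponent c (-1)) m x) / 2" for m x
  have psi: "baskakov_psi n c x = g 0 x" if "x \<ge> 0" for x
    using baskakov_sums[OF assms that] by (simp add: baskakov_psi_def g_def a_def sums_iff)
  have nonneg: "AE z in mixing_measure a. exponent c s z \<ge> 0" if "s \<in> {1, -1}" for s
    using that by (intro exponent_nonneg a assms) auto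
  show "completely_monotonic (baskakov_psi n c)"
  proof (rule completely_monotonicI)
    have "continuous_on {0..} (g 0)"
      unfolding g_def by (intro continuous_intros continuous_on_laplace_moment_0 nonneg) auto
    thus "continuous_on {0..} (baskakov_psi n c)"
      \<comment> \<open>The representation \<open>psi\<close> also holds at x = 0, so continuity
        carries over up to the endpoint.\<close>
      by (rule continuous_on_eq) (simp add: psi)
    show "(g m has_real_derivative - g (Suc m) x) (at x)" if "x > 0" for m x
    proof -
      have "(g m has_real_derivative (- laplace_moment (mixing_measure a) (exponent c 1) (Suc m) x
          + - laplace_moment (mixing_measure a) (exponent c (-1)) (Suc m) x) / 2) (at x)"
        unfolding g_def
        by (intro DERIV_cdivide DERIV_add has_derivative_laplace_moment nonneg that measurable_exponent) auto
      thus ?thesis unfolding g_def[of "Suc m"] minus_divide_left minus_add_distrib .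
    qed
    show "g m x \<ge> 0" for m x
      unfolding g_def by (intro divide_nonneg_nonneg add_nonneg_nonneg laplace_moment_nonneg nonneg) auto
  qed (simp add: psi)
qed

end
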